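(* Let $G$ be a finite, simple, connected graph such that every block of $G$ is a cycle. Then $$2\, W(G) \leq \mathrm{Sz}^*(G),$$ with equality if and only if every cycle in $G$ has even length.
   Context: A block is a maximal 2-connected subgraph in the sense of the block-cut-vertex decomposition, where a bridge together with its two end points counts as a block (so the hypothesis excludes bridges), and distinct blocks overlap only in cut vertices. $V(G)$ and $E(G)$ are the vertex and edge sets; $d_G(u,v)$ is the length of a shortest path between $u$ and $v$. The Wiener index is $$W(G) = \sum_{\{u,v\} \subseteq V(G)} d_G(u,v) = \tfrac12 \sum_{u,v \in V(G)} d_G(u,v).$$ For vertices $s,t$, $n_G(s,t)$ is the number of vertices $w$ of $G$ with $d_G(w,s) < d_G(w,t)$, and $o_G(s,t)$ is the number of vertices $w$ with $d_G(w,s) = d_G(w,t)$. The revised Szeged index is $$\mathrm{Sz}^*(G) = \sum_{\{s,t\} \in E(G)} \left(n_G(s,t) + \tfrac12 o_G(s,t)\right)\left(n_G(t,s) + \tfrac12 o_G(t,s)\right).$$ *)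

theory Defs
  imports "Graph_Theory.Graph_Theory"
begin

text \<open>
  A finite simple graph is a \<open>graph\<close> in the sense of Graph_Theory: a finite, symmetric, loop-free
  digraph without parallel arcs, so that each undirected edge \<open>{s, t}\<close> is represented by exactly
  two arcs, \<open>s \<rightarrow> t\<close> and \<open>t \<rightarrow> s\<close>.
\<close>

definition uedges :: "('a, 'b) pre_digraph \<Rightarrow> 'a set set" where
  "uedges G = (\<lambda>a. {tail G a, head G a}) ` arcs G"

text \<open>The bound on the length excludes the closed walk \<open>u \<rightarrow> v \<rightarrow> u\<close>, which
  \<open>pre_digraph.cycle\<close> admits.\<close>

definition ucycle :: "('a, 'b) pre_digraph \<Rightarrow> 'b awalk \<Rightarrow> bool" where
  "ucycle G p \<longleftrightarrow> pre_digraph.cycle G p \<and> 3 \<le> length p"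

definition cycle_graph :: "('a, 'b) pre_digraph \<Rightarrow> bool" where
  "cycle_graph H \<longleftrightarrow> graph H \<and>
     (\<exists>p. ucycle H p \<and> verts H = tail H ` set p
        \<and> uedges H = (\<lambda>a. {tail H a, head H a}) ` set p)"

definition two_connected :: "('a, 'b) pre_digraph \<Rightarrow> bool" where
  "two_connected H \<longleftrightarrow> graph H \<and> 2 < card (verts H) \<and> Digraph_Component.connected H
     \<and> (\<forall>v \<in> verts H. Digraph_Component.connected (pre_digraph.del_vert H v))"

definition del_edge :: "('a, 'b) pre_digraph \<Rightarrow> 'a \<Rightarrow> 'a \<Rightarrow> ('a, 'b) pre_digraph" where
  "del_edge G u v = G\<lparr>arcs := {a \<in> arcs G. {tail G a, head G a} \<noteq> {u, v}}\<rparr>"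

definition bridge :: "('a, 'b) pre_digraph \<Rightarrow> 'a \<Rightarrow> 'a \<Rightarrow> bool" where
  "bridge G u v \<longleftrightarrow> u \<rightarrow>\<^bsub>G\<^esub> v \<and> \<not> u \<rightarrow>\<^sup>*\<^bsub>del_edge G u v\<^esub> v"

text \<open>The one-vertex graph has no blocks under this definition.\<close>

definition is_block :: "('a, 'b) pre_digraph \<Rightarrow> ('a, 'b) pre_digraph \<Rightarrow> bool" where
  "is_block G H \<longleftrightarrow> pre_digraph.max_subgraph G two_connected H
     \<or> (\<exists>u v. bridge G u v \<and> H = G \<restriction> {u, v})"

text \<open>Meaningful only if \<open>v\<close> is reachable from \<open>u\<close>, as is always the case in a connected graph.\<close>

definition gdist :: "('a, 'b) pre_digraph \<Rightarrow> 'a \<Rightarrow> 'a \<Rightarrow> nat" where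
  "gdist G u v = (LEAST n. \<exists>p. pre_digraph.apath G u p v \<and> length p = n)"

definition wiener_index :: "('a, 'b) pre_digraph \<Rightarrow> real" where
  "wiener_index G = (1/2) * (\<Sum>u \<in> verts G. \<Sum>v \<in> verts G. real (gdist G u v))"

definition n_closer :: "('a, 'b) pre_digraph \<Rightarrow> 'a \<Rightarrow> 'a \<Rightarrow> nat" where
  "n_closer G s t = card {w \<in> verts G. gdist G w s < gdist G w t}"

definition n_equidistant :: "('a, 'b) pre_digraph \<Rightarrow> 'a \<Rightarrow> 'a \<Rightarrow> nat" where
  "n_equidistant G s t = card {w \<in> verts G. gdist G w s = gdist G w t}"

definition szeged_term :: "('a, 'b) pre_digraph \<Rightarrow> 'a \<Rightarrow> 'a \<Rightarrow> real" where
  "szeged_term G s t =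
     (real (n_closer G s t) + (1/2) * real (n_equidistant G s t))
     * (real (n_closer G t s) + (1/2) * real (n_equidistant G t s))"

text \<open>The factor \<open>1/2\<close> turns the sum over arcs into a sum over undirected edges: the summand is
  symmetric in \<open>s\<close> and \<open>t\<close>, and each edge \<open>{s, t}\<close> is counted once for each of its two arcs.\<close>

definition revised_szeged_index :: "('a, 'b) pre_digraph \<Rightarrow> real" where
  "revised_szeged_index G = (1/2) * (\<Sum>a \<in> arcs G. szeged_term G (tail G a) (head G a))"

end

theory Submission
  imports Defs
begin

text \<open>
  Put \<open>e\<^sub>s\<^sub>t(w) = d(w,s) - d(w,t)\<close> for an edge \<open>st\<close>, a number in \<open>{-1,0,1}\<close>. The key fact is that \<open>G\<close>
  embeds isometrically in an \<open>l\<^sub>1\<close> space: the sum of \<open>|e\<^sub>s\<^sub>t(u) - e\<^sub>s\<^sub>t(v)|\<close> over all arcs is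
  \<open>8 d(u,v)\<close>. Indeed, moving \<open>v\<close> along an edge of a block \<open>C\<close> does not change \<open>e\<^sub>s\<^sub>t(v)\<close> for \<open>st\<close>
  outside \<open>C\<close>, because \<open>s\<close> and \<open>t\<close> have the same projection to \<open>C\<close>, and on \<open>C\<close> itself the claim
  is a computation on a cycle. Since \<open>1 - e e' = |e - e'| + [e = e' = 0]\<close> on \<open>{-1,0,1}\<close>, summing the
  products in the revised Szeged index over all pairs of vertices gives
  \<open>8 (Sz\<^sup>* - 2 W) = \<Sum> o(s,t)\<^sup>2\<close>, the sum being over all arcs. An edge of a block of length \<open>n\<close> has an
  equidistant vertex if and only if \<open>n\<close> is odd.
\<close>

section \<open>Distances on a cycle\<close>

text \<open>The distance between the residues \<open>0\<close> and \<open>t\<close> on a cycle of length \<open>n\<close>.\<close>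

definition cyc_norm :: "nat \<Rightarrow> int \<Rightarrow> int" where
  "cyc_norm n t = min (t mod int n) (int n - t mod int n)"

text \<open>The value \<open>e\<^sub>s\<^sub>t(w)\<close> of the overview when \<open>w\<close>,
  \<open>s\<close> and \<open>t\<close> are the residues 0, \<open>t\<close> and
  \<open>t + 1\<close> of the cycle.\<close>

definition cyc_slope :: "nat \<Rightarrow> int \<Rightarrow> int" where
  "cyc_slope n t = cyc_norm n t - cyc_norm n (t + 1)"

lemma cyc_norm_of_le:
  assumes "0 \<le> t" "t \<le> int n"
  shows "cyc_norm n t = min t (int n - t)"
  using assms by (cases "t = int n") (auto simp: cyc_norm_def)

lemma cyc_norm_cong: "s mod int n = t mod int n \<Longrightarrow> cyc_norm n s = cyc_norm n t"
  by (simp add: cyc_norm_def)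

lemma cyc_norm_zero [simp]: "cyc_norm n 0 = 0"
  by (simp add: cyc_norm_def)

lemma cyc_slope_of_less:
  assumes "0 \<le> t" "t < int n"
  shows "cyc_slope n t = min t (int n - t) - min (t + 1) (int n - t - 1)"
  using assms by (simp add: cyc_slope_def cyc_norm_of_le)

lemma cyc_slope_cong: 
  assumes "s mod int n = t mod int n"
  shows "cyc_slope n s = cyc_slope n t"
proof -
  have "(s + 1) mod int n = (t + 1) mod int n"
    using assms by (metis mod_add_left_eq)
  then show ?thesis
    unfolding cyc_slope_def using assms by (metis cyc_norm_cong)
qed

text \<open>On one period \<open>cyc_norm n\<close> is the minimum of two linear functions, hence
  concave, and \<open>cyc_slope n\<close> is its negated increment.\<close>

lemma cyc_slope_mono:
  assumes "0 \<le> s" "s \<le> t" "t < int n"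
  shows "cyc_slope n s \<le> cyc_slope n t"
  using assms by (simp add: cyc_slope_of_less)

lemma cyc_slope_abs_le: 
  assumes "0 < n" shows "\<bar>cyc_slope n t\<bar> \<le> 1"
proof -
  have "cyc_slope n t = cyc_slope n (t mod int n)" by (rule cyc_slope_cong) simp
  moreover have "0 \<le> t mod int n" "t mod int n < int n" using assms by auto
  ultimately show ?thesis by (simp add: cyc_slope_of_less)
qed

lemma cyc_slope_nonzero: 
  assumes "0 < n" "even n" shows "cyc_slope n t \<noteq> 0"
proof -
  have "cyc_slope n t = cyc_slope n (t mod int n)" by (rule cyc_slope_cong) simp
  moreover have "0 \<le> t mod int n" "t mod int n < int n" using assms by auto
  \<comment> \<open>Among the residues below \<open>n\<close>, the slope vanishes only where
    \<open>2t = n - 1\<close>, at the edge opposite to 0 on an odd cycle.\<close>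
  moreover have "2 * (t mod int n) \<noteq> int n - 1"
  proof
    assume "2 * (t mod int n) = int n - 1"
    then have "int n = 2 * (t mod int n) + 1" by linarith
    then have "odd (int n)" by (metis odd_two_times_div_two_succ even_mult_iff even_plus_one_iff even_numeral)
    with \<open>even n\<close> show False by simp
  qed
  ultimately show ?thesis by (auto simp: cyc_slope_of_less min_def)
qed

text \<open>One of the two arcs between 0 and \<open>t\<close> has length
  \<open>cyc_norm n t\<close>; \<open>k\<close> is that length and the case gives the direction of
  travel.\<close>

lemma cyc_norm_cases:
  assumes "0 < n"
  obtains k where "t mod int n = int k mod int n" "cyc_norm n t = int k"
    | k where "t mod int n = (- int k) mod int n" "cyc_norm n t = int k"
proof (cases "t mod int n \<le> int n - t mod int n")
  case True
  then show ?thesis using assms that(1)[of "nat (t mod int n)"] by (simp add: cyc_norm_def)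
next
  case False
  then have "t mod int n = (- int (nat (int n - t mod int n))) mod int n"
    using assms by (simp add: mod_simps less_imp_le)
  then show ?thesis using assms False that(2)[of "nat (int n - t mod int n)"]
    by (simp add: cyc_norm_def less_imp_le)
qed

lemma sum_periodic_shift:
  fixes f :: "int \<Rightarrow> int"
  assumes "0 < n" and per: "\<And>s t. s mod int n = t mod int n \<Longrightarrow> f s = f t"
  shows "(\<Sum>j<n. f (int j + a)) = (\<Sum>j<n. f (int j))"
proof -
  have nat: "(\<Sum>j<n. f (int j + int b)) = (\<Sum>j<n. f (int j))" for b
  proof (induction b)
    case (Suc b)
    have "(\<Sum>j<n. f (int j + int (Suc b))) + f (int 0 + int b) = (\<Sum>j<Suc n. f (int j + int b))"
      by (simp only: sum.lessThan_Suc_shift) (simp add: algebra_simps)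
    also have "\<dots> = (\<Sum>j<n. f (int j + int b)) + f (int n + int b)" by simp
    also have "f (int n + int b) = f (int 0 + int b)" by (rule per) simp
    finally show ?case using Suc by simp
  qed simp
  have "(\<Sum>j<n. f (int j + a)) = (\<Sum>j<n. f (int j + int (nat (a mod int n))))"
    using \<open>0 < n\<close> by (intro sum.cong refl per) (simp add: mod_simps)
  then show ?thesis using nat[of "nat (a mod int n)"] by simp
qed

lemma sum_lessThan_add:
  fixes f :: "nat \<Rightarrow> 'a :: comm_monoid_add"
  shows "(\<Sum>j<m + d. f j) = (\<Sum>j<m. f j) + (\<Sum>j<d. f (m + j))"
  by (induction d) (simp_all add: ac_simps)

lemma sum_cyc_slope: "(\<Sum>j<m. cyc_slope n (a + int j)) = cyc_norm n a - cyc_norm n (a + int m)"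
  by (induction m) (simp_all add: cyc_slope_def algebra_simps)

text \<open>After a shift, the two slopes are taken at \<open>t + d\<close> and \<open>t\<close>,
  where \<open>d\<close> is the offset of the two vertices. By monotonicity on a period the
  difference is nonnegative as long as \<open>t + d\<close> stays below \<open>n\<close>; for the
  last \<open>d\<close> indices \<open>t + d\<close> wraps around and the sign reverses. Both
  partial sums then telescope, each to \<open>cyc_norm n d + cyc_norm n (n - d)\<close>, and these
  two norms are equal.\<close>

lemma sum_cyc_slope_diff:
  assumes "0 < n"
  shows "(\<Sum>j<n. \<bar>cyc_slope n (int j - k) - cyc_slope n (int j - i)\<bar>) = 4 * cyc_norm n (i - k)"
proof -
  define d where "d = nat ((i - k) mod int n)"
  have d: "int d = (i - k) mod int n" "d < n" using assms by (auto simp: d_def nat_less_iff)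
  let ?E = "cyc_slope n" and ?r = "cyc_norm n"
  let ?f = "\<lambda>t. \<bar>?E (t + int d) - ?E t\<bar>"
  have "(\<Sum>j<n. \<bar>?E (int j - k) - ?E (int j - i)\<bar>) = (\<Sum>j<n. ?f (int j + - i))"
    by (intro sum.cong refl arg_cong[where f=abs] arg_cong2[where f="(-)"] cyc_slope_cong)
      (simp_all add: d mod_simps)
  also have "\<dots> = (\<Sum>j<n. ?f (int j))"
    using assms by (intro sum_periodic_shift arg_cong[where f=abs] arg_cong2[where f="(-)"] cyc_slope_cong)
      (auto intro: mod_add_cong)
  also have "\<dots> = (\<Sum>j<n-d. ?f (int j)) + (\<Sum>j<d. ?f (int (n - d) + int j))"
    using sum_lessThan_add[of "\<lambda>j. ?f (int j)" "n - d" d] d(2) by (simp only: of_nat_add) simp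
  also have "(\<Sum>j<n-d. ?f (int j)) = (\<Sum>j<n-d. ?E (int d + int j) - ?E (0 + int j))"
  proof (intro sum.cong refl)
    fix j assume "j \<in> {..<n - d}"
    then have "?E (0 + int j) \<le> ?E (int d + int j)"
      by (intro cyc_slope_mono) auto
    then show "?f (int j) = ?E (int d + int j) - ?E (0 + int j)" by (simp add: add.commute)
  qed
  also have "(\<Sum>j<d. ?f (int (n - d) + int j)) = (\<Sum>j<d. ?E (int (n - d) + int j) - ?E (0 + int j))"
  proof (intro sum.cong refl)
    fix j assume "j \<in> {..<d}"
    moreover have "?E (int (n - d) + int j + int d) = ?E (0 + int j)"
      using d by (intro cyc_slope_cong) (simp add: of_nat_diff)
    moreover have "?E (0 + int j) \<le> ?E (int (n - d) + int j)"
      using d \<open>j \<in> {..<d}\<close> by (intro cyc_slope_mono) auto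
    ultimately show "?f (int (n - d) + int j) = ?E (int (n - d) + int j) - ?E (0 + int j)" by simp
  qed
  finally have "(\<Sum>j<n. \<bar>?E (int j - k) - ?E (int j - i)\<bar>)
      = (?r (int d) - ?r (int d + int (n - d))) - (?r 0 - ?r (0 + int (n - d)))
      + ((?r (int (n - d)) - ?r (int (n - d) + int d)) - (?r 0 - ?r (0 + int d)))"
    unfolding sum_subtractf sum_cyc_slope by simp
  also have "\<dots> = 4 * ?r (int d)"
    using d by (simp add: cyc_norm_of_le)
  also have "?r (int d) = ?r (i - k)" by (rule cyc_norm_cong) (simp add: d)
  finally show ?thesis .
qed

section \<open>Blocks\<close>

text \<open>A chain of least length has no repetition: excising the part between two equal points
  would shorten it.\<close>

lemma rtrancl_simple_path:
  assumes "(x, y) \<in> S\<^sup>*"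
  obtains m q where "q 0 = x" "q m = y" "inj_on q {..m}" "\<forall>i<m. (q i, q (Suc i)) \<in> S"
proof -
  define m where "m = (LEAST n. (x, y) \<in> S ^^ n)"
  have "(x, y) \<in> S ^^ m"
    unfolding m_def using assms by (metis LeastI rtrancl_power)
  then obtain q where q: "q 0 = x" "q m = y" "\<And>i. i < m \<Longrightarrow> (q i, q (Suc i)) \<in> S"
    by (auto simp: relpow_fun_conv)
  have seg: "(q i, q j) \<in> S ^^ (j - i)" if "i \<le> j" "j \<le> m" for i j
    unfolding relpow_fun_conv using that q
    by (intro exI[of _ "\<lambda>l. q (i + l)"]) auto
  have "q i \<noteq> q j" if "i < j" "j \<le> m" for i j
  proof
    assume "q i = q j"
    have "(x, y) \<in> S ^^ ((i - 0) + (m - j))"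
      unfolding relpow_add using seg[of 0 i] seg[of j m] that q \<open>q i = q j\<close> by auto
    then have "m \<le> i + (m - j)" unfolding m_def by (simp add: Least_le)
    with that show False by simp
  qed
  then have "inj_on q {..m}"
    by (metis atMost_iff inj_onI linorder_neqE_nat)
  with q show thesis using that by blast
qed

text \<open>As \<open>z\<close> need not lie in \<open>W\<close>, this includes connectedness whenever \<open>W\<close> is not the whole type.
  Unlike 2-connectedness it also holds for a single edge, so that a cycle is an ear on an edge.\<close>

definition robust :: "'a set \<Rightarrow> 'a rel \<Rightarrow> bool" where
  "robust W R \<longleftrightarrow> (\<forall>z. \<forall>u \<in> W - {z}. \<forall>v \<in> W - {z}. (u, v) \<in> (Restr R (- {z}))\<^sup>*)"

definition path_edges :: "(nat \<Rightarrow> 'a) \<Rightarrow> nat \<Rightarrow> 'a rel" where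
  "path_edges q m = (\<Union>i<m. {(q i, q (Suc i)), (q (Suc i), q i)})"

lemma sym_path_edges: "sym (path_edges q m)"
  by (auto simp: path_edges_def sym_def)

lemma robust_edge: "robust {x, y} {(x, y), (y, x)}"
proof -
  have "(u, v) \<in> (Restr {(x, y), (y, x)} (- {z}))\<^sup>*"
    if "u \<in> {x, y} - {z}" "v \<in> {x, y} - {z}" for u v z
    using that by (cases "u = v") (auto intro!: r_into_rtrancl)
  then show ?thesis unfolding robust_def by blast
qed

text \<open>The removed \<open>z\<close> occurs at most once on the path, so from every other vertex
  of the ear at least one of the two directions leads to \<open>W\<close> without meeting
  \<open>z\<close>. The rest of the way is available inside \<open>W\<close>.\<close>

lemma robust_ear:
  assumes rob: "robust W R" and "sym R" and xy: "q 0 \<in> W" "q m \<in> W" and inj: "inj_on q {..m}"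
  shows "robust (W \<union> q ` {..m}) (R \<union> path_edges q m)"
proof -
  have "(u, v) \<in> (Restr (R \<union> path_edges q m) (- {z}))\<^sup>*"
    if u: "u \<in> (W \<union> q ` {..m}) - {z}" and v: "v \<in> (W \<union> q ` {..m}) - {z}" for u v z
  proof -
    let ?S = "Restr (R \<union> path_edges q m) (- {z})"
    have "sym ?S" using \<open>sym R\<close> sym_path_edges[of q m] by (auto simp: sym_def)
    then have sym: "sym (?S\<^sup>*)" by (rule sym_rtrancl)
    have step: "(q i, q (Suc i)) \<in> ?S" if "i < m" "q i \<noteq> z" "q (Suc i) \<noteq> z" for i
      using that by (auto simp: path_edges_def)
    have seg: "(q i, q j) \<in> ?S\<^sup>*" if "i \<le> j" "j \<le> m" "z \<notin> q ` {i..j}" for i j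
      using that
    proof (induction j)
      case (Suc j)
      show ?case
      proof (cases "i = Suc j")
        case False
        with Suc have "(q i, q j) \<in> ?S\<^sup>*" by (auto simp: image_iff)
        moreover have "(q j, q (Suc j)) \<in> ?S"
          using Suc.prems False by (intro step) (auto simp: image_iff)
        ultimately show ?thesis by (rule rtrancl_into_rtrancl)
      qed simp
    qed simp
    have to_W: "\<exists>w' \<in> W - {z}. (w, w') \<in> ?S\<^sup>*" if w: "w \<in> (W \<union> q ` {..m}) - {z}" for w
    proof (cases "w \<in> W")
      case False
      with w obtain i where i: "i \<le> m" "w = q i" by auto
      show ?thesis
      proof (cases "z \<in> q ` {0..i}")
        case False
        then have "q 0 \<noteq> z" by (auto simp: image_iff)
        moreover have "(w, q 0) \<in> ?S\<^sup>*" using False i seg[of 0 i] sym by (auto dest: symD)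
        ultimately show ?thesis using xy by auto
      next
        case True
        then obtain l where l: "l < i" "z = q l" using w i by (auto simp: le_less)
        have "z \<noteq> q j" if "i \<le> j" "j \<le> m" for j
          using inj_onD[OF inj, of l j] l that by auto
        then have "z \<notin> q ` {i..m}" by fastforce
        moreover then have "q m \<noteq> z" using i by (auto simp: image_iff)
        ultimately show ?thesis using seg[of i m] i xy by auto
      qed
    qed (use w in auto)
    obtain u' v' where u': "u' \<in> W - {z}" "(u, u') \<in> ?S\<^sup>*" and v': "v' \<in> W - {z}" "(v, v') \<in> ?S\<^sup>*"
      using to_W[OF u] to_W[OF v] by blast
    have "(u', v') \<in> (Restr R (- {z}))\<^sup>*" using rob u' v' by (auto simp: robust_def)
    also have "\<dots> \<subseteq> ?S\<^sup>*" by (rule rtrancl_mono) auto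
    finally have "(u', v') \<in> ?S\<^sup>*" .
    then show ?thesis using u' v' sym by (meson rtrancl_trans symD)
  qed
  then show ?thesis unfolding robust_def by blast
qed

section \<open>2-connectedness expressed by robustness\<close>

lemma connected_iff:
  assumes "wf_digraph H" "symmetric H"
  shows "Digraph_Component.connected H \<longleftrightarrow>
    verts H \<noteq> {} \<and> (\<forall>u \<in> verts H. \<forall>v \<in> verts H. (u, v) \<in> (arcs_ends H)\<^sup>*)"
proof -
  interpret wf_digraph H by fact
  have "(arcs_ends H)\<^sup>s = arcs_ends H"
    using assms(2) by (auto simp: symcl_def symmetric_def sym_def)
  then show ?thesis
    using reachable_conv' by (auto simp: connected_conv reachable_def)
qed

lemma arcs_ends_del_vert: "arcs_ends (pre_digraph.del_vert H z) = Restr (arcs_ends H) (- {z})"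
  by (auto simp: arcs_ends_conv pre_digraph.del_vert_simps)

text \<open>For \<open>z\<close> in \<open>verts H\<close> robustness says that
  \<open>del_vert H z\<close> is connected; for \<open>z\<close> outside it says that
  \<open>H\<close> itself is.\<close>

lemma two_connected_iff_robust:
  assumes "graph H" "2 < card (verts H)"
  shows "two_connected H \<longleftrightarrow> robust (verts H) (arcs_ends H)"
proof -
  interpret graph H by fact
  have sym: "symmetric H" by (rule sym_arcs)
  have del: "Digraph_Component.connected (pre_digraph.del_vert H z) \<longleftrightarrow>
      (\<forall>u \<in> verts H - {z}. \<forall>v \<in> verts H - {z}. (u, v) \<in> (Restr (arcs_ends H) (- {z}))\<^sup>*)" for z
  proof -
    have "symmetric (pre_digraph.del_vert H z)"
      using sym by (auto simp: symmetric_def arcs_ends_del_vert sym_def)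
    moreover have "verts H - {z} \<noteq> {}"
    proof
      assume "verts H - {z} = {}"
      then have "card (verts H) \<le> card {z}" by (intro card_mono) auto
      with assms(2) show False by simp
    qed
    ultimately show ?thesis
      by (simp add: connected_iff wf_digraph_del_vert arcs_ends_del_vert verts_del_vert)
  qed
  have conn: "Digraph_Component.connected H" if rob: "robust (verts H) (arcs_ends H)"
  proof -
    have "(u, v) \<in> (arcs_ends H)\<^sup>*" if "u \<in> verts H" "v \<in> verts H" for u v
    proof -
      \<comment> \<open>Robustness gives reachability only after removal of some \<open>z\<close>,
        and the type may have no element outside \<open>verts H\<close>. A third vertex of
        \<open>H\<close> serves as \<open>z\<close>.\<close>
      have "\<not> verts H \<subseteq> {u, v}"
        using assms(2) card_mono[of "{u, v}" "verts H"] card_insert_le_m1[of 2 "{v}" u] by fastforce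
      then obtain z where "z \<in> verts H" "z \<noteq> u" "z \<noteq> v" by auto
      then have "(u, v) \<in> (Restr (arcs_ends H) (- {z}))\<^sup>*"
        using rob that by (auto simp: robust_def)
      then show ?thesis by (rule rtrancl_mono[THEN subsetD, rotated]) auto
    qed
    then show ?thesis using assms(2) by (auto simp: connected_iff[OF wf_digraph sym])
  qed
  have out: "(u, v) \<in> (Restr (arcs_ends H) (- {z}))\<^sup>*"
    if "Digraph_Component.connected H" "z \<notin> verts H" "u \<in> verts H" "v \<in> verts H" for u v z
  proof -
    have "Restr (arcs_ends H) (- {z}) = arcs_ends H"
      using that(2) by (auto dest: adj_in_verts)
    then show ?thesis using that by (simp add: connected_iff[OF wf_digraph sym])
  qed
  show ?thesis
  proof
    assume "two_connected H"
    then show "robust (verts H) (arcs_ends H)"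
      unfolding robust_def two_connected_def using del out by (metis Diff_iff)
  next
    assume "robust (verts H) (arcs_ends H)"
    then show "two_connected H"
      unfolding two_connected_def using del conn assms by (simp add: robust_def)
  qed
qed

section \<open>Subgraphs given by an edge relation, and maximal subgraphs\<close>

definition edge_subgraph :: "('a, 'b) pre_digraph \<Rightarrow> 'a set \<Rightarrow> 'a rel \<Rightarrow> ('a, 'b) pre_digraph" where
  "edge_subgraph G W R =
    \<lparr>verts = W, arcs = {a \<in> arcs G. (tail G a, head G a) \<in> R}, tail = tail G, head = head G\<rparr>"

lemma (in graph) edge_subgraph:
  assumes "W \<subseteq> verts G" "R \<subseteq> arcs_ends G" "sym R" "R \<subseteq> W \<times> W"
  shows "subgraph (edge_subgraph G W R) G" "graph (edge_subgraph G W R)"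
    "arcs_ends (edge_subgraph G W R) = R" "verts (edge_subgraph G W R) = W"
proof -
  let ?H = "edge_subgraph G W R"
  show ends: "arcs_ends ?H = R" and [simp]: "verts ?H = W"
    using assms(2) by (auto simp: edge_subgraph_def arcs_ends_conv)
  have "wf_digraph ?H"
    using assms(4) by unfold_locales (auto simp: edge_subgraph_def)
  then interpret H: wf_digraph ?H .
  show "subgraph ?H G"
    using assms(1) H.wf_digraph wf_digraph
    by (auto simp: subgraph_def compatible_def edge_subgraph_def)
  show "graph ?H"
  proof
    show "finite (verts ?H)" using assms(1) by (auto intro: finite_subset)
    show "finite (arcs ?H)" by (rule finite_subset[of _ "arcs G"]) (auto simp: edge_subgraph_def)
    show "symmetric ?H" using assms(3) by (simp add: symmetric_def ends)
  qed (auto simp: edge_subgraph_def arc_to_ends_def no_loops intro: no_multi_arcs)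
qed

text \<open>Among the candidates above \<open>K\<close>, one with the largest number of vertices
  plus arcs is maximal: a candidate containing it has the same counts, hence the same vertex and arc
  sets.\<close>

lemma (in fin_digraph) subgraph_of_max_subgraph:
  assumes "subgraph K G" "P K"
  obtains H where "max_subgraph P H" "subgraph K H"
proof -
  let ?Q = "\<lambda>H. subgraph H G \<and> P H \<and> subgraph K H"
  let ?f = "\<lambda>H. card (verts H) + card (arcs H)"
  have "?Q K" using assms by (auto simp: subgraph_def compatible_def)
  moreover have "?f H < Suc (?f G)" if "?Q H" for H
    using that by (auto simp: subgraph_def less_Suc_eq_le intro!: add_mono card_mono)
  ultimately obtain H where H: "?Q H" and max: "\<And>H'. ?Q H' \<Longrightarrow> ?f H' \<le> ?f H"
    using ex_has_greatest_nat[of ?Q K ?f "Suc (?f G)"] by (metis less_imp_le)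
  have "H' = H" if H': "subgraph H H'" "subgraph H' G" "P H'" for H'
  proof -
    have "subgraph K H'" using H H' subgraph_trans by blast
    then have le: "?f H' \<le> ?f H" using H' max by blast
    have fin: "finite (verts H')" "finite (arcs H')"
      using H'(2) by (auto simp: subgraph_def intro: finite_subset)
    have sub: "verts H \<subseteq> verts H'" "arcs H \<subseteq> arcs H'" using H'(1) by auto
    have "card (verts H) \<le> card (verts H')" "card (arcs H) \<le> card (arcs H')"
      using fin sub by (auto intro: card_mono)
    then have "verts H = verts H'" "arcs H = arcs H'"
      using fin sub le by (simp_all add: card_subset_eq)
    moreover have "tail H = tail H'" "head H = head H'"
      using H'(1) by (auto simp: subgraph_def compatible_def)
    ultimately show ?thesis by (cases H, cases H') simp
  qed
  with H have "max_subgraph P H" by (auto simp: max_subgraph_def)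
  with H show thesis using that by blast
qed

section \<open>Distances from the vertices of a block cycle\<close>

locale connected_graph = graph +
  assumes connected: "Digraph_Component.connected G"
begin

abbreviation (input) dist :: "'a \<Rightarrow> 'a \<Rightarrow> int" where
  "dist u v \<equiv> int (gdist G u v)"

lemma sym_ends: "sym (arcs_ends G)"
  using sym_arcs by (simp add: symmetric_def)

lemma finite_ends: "finite (arcs_ends G)"
  by (simp add: arcs_ends_def)

lemma rtrancl_ends: "u \<in> verts G \<Longrightarrow> v \<in> verts G \<Longrightarrow> (u, v) \<in> (arcs_ends G)\<^sup>*"
  using connected by (simp add: connected_iff[OF wf_digraph sym_arcs])

text \<open>\<open>gdist\<close> minimizes over paths only. Shortening a walk to a path leaves
  distinct arcs taken from the walk, so the length does not grow.\<close>

lemma gdist_le_length: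
  assumes "awalk u p v"
  shows "gdist G u v \<le> length p"
proof -
  have ap: "apath u (awalk_to_apath p) v" using assms by (rule apath_awalk_to_apath)
  then have "distinct (awalk_to_apath p)" by (auto simp: apath_def intro: distinct_verts_imp_distinct)
  then have "length (awalk_to_apath p) \<le> length p"
    using card_mono[OF _ awalk_to_apath_subset[OF assms]] card_length[of p]
    by (simp add: distinct_card)
  moreover have "gdist G u v \<le> length (awalk_to_apath p)"
    unfolding gdist_def using ap by (intro Least_le) auto
  ultimately show ?thesis by simp
qed

lemma obtain_geodesic:
  assumes "u \<in> verts G" "v \<in> verts G"
  obtains p where "awalk u p v" "length p = gdist G u v"
proof -
  have "\<exists>p. apath u p v"
    using assms rtrancl_ends[OF assms] by (simp add: reachable_apath[symmetric] reachable_conv)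
  then have "\<exists>p. apath u p v \<and> length p = gdist G u v"
    unfolding gdist_def by (intro LeastI_ex[of "\<lambda>n. \<exists>p. apath u p v \<and> length p = n"]) auto
  then show thesis using that by (auto simp: apath_def)
qed

lemma dist_refl [simp]: "u \<in> verts G \<Longrightarrow> gdist G u u = 0"
  using gdist_le_length[of u "[]" u] by (simp add: awalk_Nil_iff)

lemma dist_step:
  assumes "w \<in> verts G" "(s, t) \<in> arcs_ends G"
  shows "dist w t \<le> dist w s + 1"
proof -
  obtain a where a: "a \<in> arcs G" "tail G a = s" "head G a = t" using assms(2) by auto
  then obtain p where "awalk w p s" "length p = gdist G w s"
    using obtain_geodesic assms(1) tail_in_verts by metis
  then have "awalk w (p @ [a]) t" using arc_implies_awalk[OF a(1)] a by (auto intro: awalk_appendI)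
  then show ?thesis using gdist_le_length[of w "p @ [a]" t] \<open>length p = _\<close> by simp
qed

text \<open>The source of lower bounds for distances: it suffices to find a potential
  \<open>h\<close> that rises by at most 1 along each arc.\<close>

lemma lipschitz_dist:
  fixes h :: "'a \<Rightarrow> int"
  assumes "u \<in> verts G" "v \<in> verts G" and lip: "\<And>s t. (s, t) \<in> arcs_ends G \<Longrightarrow> h t \<le> h s + 1"
  shows "h v \<le> h u + dist u v"
proof -
  obtain p where p: "awalk u p v" "length p = gdist G u v" using obtain_geodesic assms by metis
  have "h v \<le> h u + int (length p)"
    using p(1)
  proof (induction p arbitrary: u)
    case (Cons a p)
    then show ?case using lip[of u "head G a"] by (force simp: awalk_Cons_iff arcs_ends_conv)
  qed (simp add: awalk_Nil_iff)
  then show ?thesis using p(2) by simp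
qed

lemma dist_triangle: 
  "u \<in> verts G \<Longrightarrow> v \<in> verts G \<Longrightarrow> w \<in> verts G \<Longrightarrow> dist u w \<le> dist u v + dist v w"
  by (rule lipschitz_dist) (auto intro: dist_step)

lemma dist_sym:
  assumes "u \<in> verts G" "v \<in> verts G"
  shows "gdist G u v = gdist G v u"
proof -
  have le: "dist y x \<le> dist x y" if "x \<in> verts G" "y \<in> verts G" for x y
  proof -
    have "dist t x \<le> dist s x + 1" if st: "(s, t) \<in> arcs_ends G" for s t
    proof -
      obtain a where a: "a \<in> arcs G" "tail G a = t" "head G a = s"
        using st sym_ends by (auto dest: symD)
      then obtain p where "awalk s p x" "length p = gdist G s x"
        using obtain_geodesic \<open>x \<in> verts G\<close> head_in_verts by metis
      then show ?thesis using gdist_le_length[of t "a # p" x] a by (simp add: awalk_Cons_iff)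
    qed
    then show ?thesis using lipschitz_dist[of x y "\<lambda>s. dist s x"] that by simp
  qed
  show ?thesis using le[of u v] le[of v u] assms by simp
qed

text \<open>The number \<open>e\<^sub>s\<^sub>t(w)\<close> of the overview.\<close>

definition slope :: "'a \<Rightarrow> 'a \<Rightarrow> 'a \<Rightarrow> int" where
  "slope s t w = dist w s - dist w t"

lemma slope_abs_le:
  assumes "w \<in> verts G" "(s, t) \<in> arcs_ends G"
  shows "\<bar>slope s t w\<bar> \<le> 1"
  using dist_step[of w s t] dist_step[of w t s] assms sym_ends
  by (auto simp: slope_def abs_if dest: symD)

text \<open>The l1 distance between the slope vectors of \<open>u\<close> and \<open>v\<close>. Each
  edge occurs in both orientations, which turns the factor 4 of \<open>sum_cyc_slope_diff\<close>
  into 8.\<close>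

definition cut_dist :: "'a \<Rightarrow> 'a \<Rightarrow> int" where
  "cut_dist u v = (\<Sum>(s, t) \<in> arcs_ends G. \<bar>slope s t u - slope s t v\<bar>)"

end

section \<open>Block cycles and the projection onto them\<close>

definition cycle_edges :: "(int \<Rightarrow> 'a) \<Rightarrow> 'a rel" where
  "cycle_edges c = (\<Union>i. {(c i, c (i + 1)), (c (i + 1), c i)})"

lemma sym_cycle_edges: "sym (cycle_edges c)"
  by (auto simp: cycle_edges_def sym_def)

text \<open>Indexing by all integers modulo \<open>n\<close> makes the closing edge an edge like the
  others. \<open>separated\<close> is the form in which the maximality of a block enters: nothing
  but the edges of the cycle connects two of its vertices.\<close>

locale block_cycle = connected_graph +
  fixes n :: nat and c :: "int \<Rightarrow> 'a"
  assumes n_ge: "3 \<le> n"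
    and c_eq_iff: "c i = c j \<longleftrightarrow> i mod int n = j mod int n"
    and c_step: "(c i, c (i + 1)) \<in> arcs_ends G"
    and separated: "(c i, c j) \<in> (arcs_ends G - cycle_edges c)\<^sup>* \<Longrightarrow> c i = c j"
begin

lemma n_pos: "0 < n" using n_ge by simp

lemma c_in_verts [simp]: "c i \<in> verts G"
  using c_step adj_in_verts by blast

lemma cycle_edges_subset: "cycle_edges c \<subseteq> arcs_ends G"
  using c_step sym_ends by (auto simp: cycle_edges_def dest: symD)

abbreviation "rest \<equiv> arcs_ends G - cycle_edges c"

lemma sym_rest: "sym (rest\<^sup>*)"
  using sym_ends sym_cycle_edges[of c] by (intro sym_rtrancl symI) (blast dest: symD)

text \<open>After deletion of the cycle edges, each vertex \<open>w\<close> is connected to exactly one vertex of the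
  cycle, \<open>c (proj w)\<close>; the index itself is determined only modulo \<open>n\<close>.\<close>

definition proj :: "'a \<Rightarrow> int" where
  "proj w = (SOME i. (c i, w) \<in> rest\<^sup>*)"

text \<open>Along a walk from \<open>c 0\<close> to \<open>w\<close>, the part after the last cycle
  edge starts on the cycle and uses only other edges.\<close>

lemma proj:
  assumes "w \<in> verts G"
  shows "(c (proj w), w) \<in> rest\<^sup>*"
proof -
  have "(c 0, w) \<in> (arcs_ends G)\<^sup>*" using rtrancl_ends assms by simp
  then have "\<exists>i. (c i, w) \<in> rest\<^sup>*"
  proof induction
    case (step s t)
    show ?case
    proof (cases "(s, t) \<in> cycle_edges c")
      case True
      then show ?thesis by (auto simp: cycle_edges_def)
    next
      case False
      with step show ?thesis by (meson DiffI rtrancl_into_rtrancl)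
    qed
  qed auto
  then show ?thesis unfolding proj_def by (rule someI_ex)
qed

lemma proj_eqI:
  assumes "w \<in> verts G" "(c i, w) \<in> rest\<^sup>*"
  shows "proj w mod int n = i mod int n"
  using proj[OF assms(1)] assms(2) separated sym_rest c_eq_iff by (meson rtrancl_trans symD)

lemma proj_c: "proj (c i) mod int n = i mod int n"
  by (rule proj_eqI) auto

lemma proj_step:
  assumes "(s, t) \<in> rest"
  shows "proj t mod int n = proj s mod int n"
proof (rule proj_eqI)
  show "t \<in> verts G" using assms adj_in_verts by auto
  have "s \<in> verts G" using assms adj_in_verts by auto
  then show "(c (proj s), t) \<in> rest\<^sup>*" using proj assms by (meson rtrancl_into_rtrancl)
qed

lemma dist_c_le: "dist (c i) (c j) \<le> cyc_norm n (j - i)"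
proof -
  have walk: "dist (c a) (c (a + int k)) \<le> int k" for a k
  proof (induction k)
    case (Suc k)
    then show ?case using dist_step[of "c a" "c (a + int k)" "c (a + int (Suc k))"] c_step[of "a + int k"]
      by (simp add: algebra_simps)
  qed simp
  show ?thesis
  proof (cases rule: cyc_norm_cases[OF n_pos, of "j - i"])
    case (1 k)
    then have "c j = c (i + int k)" by (simp add: c_eq_iff mod_eq_dvd_iff algebra_simps)
    then show ?thesis using walk[of i k] 1 by simp
  next
    case (2 k)
    then have "c j = c (i - int k)" by (simp add: c_eq_iff mod_eq_dvd_iff algebra_simps)
    then show ?thesis using walk[of "i - int k" k] 2 by (simp add: dist_sym)
  qed
qed

text \<open>The vertex \<open>c (proj w)\<close> is the gate from \<open>w\<close> to the cycle. The
  upper bound is the triangle inequality. For the lower bound the right-hand side, as a function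
  \<open>h\<close> of \<open>w\<close>, is a potential: along a cycle edge its first term stays 0
  and the second changes by at most 1; along any other edge the projection is fixed and only the
  first term changes. Moreover \<open>h (c j) = 0\<close>.\<close>

lemma dist_c:
  assumes w: "w \<in> verts G"
  shows "dist w (c j) = dist w (c (proj w)) + cyc_norm n (j - proj w)"
proof (rule antisym)
  show "dist w (c j) \<le> dist w (c (proj w)) + cyc_norm n (j - proj w)"
    using dist_triangle[of w "c (proj w)" "c j"] dist_c_le[of "proj w" j] w by simp
  define h where "h x = dist x (c (proj x)) + cyc_norm n (j - proj x)" for x
  have h_c: "h (c i) = cyc_norm n (j - i)" for i
  proof -
    have "c (proj (c i)) = c i" using proj_c by (simp add: c_eq_iff)
    moreover have "cyc_norm n (j - proj (c i)) = cyc_norm n (j - i)"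
      using proj_c by (intro cyc_norm_cong) (rule mod_diff_cong[OF refl])
    ultimately show ?thesis by (simp add: h_def)
  qed
  have "h t \<le> h s + 1" if st: "(s, t) \<in> arcs_ends G" for s t
  proof (cases "(s, t) \<in> cycle_edges c")
    case True
    have "\<bar>h (c i) - h (c (i + 1))\<bar> \<le> 1" for i
      using cyc_slope_abs_le[OF n_pos, of "j - (i + 1)"]
      by (simp add: h_c cyc_slope_def algebra_simps abs_minus_commute)
    then have "h (c i) \<le> h (c (i + 1)) + 1 \<and> h (c (i + 1)) \<le> h (c i) + 1" for i
      by (metis abs_diff_le_iff diff_le_eq add.commute le_diff_eq)
    then show ?thesis using True by (auto simp: cycle_edges_def)
  next
    case False
    then have eq: "proj t mod int n = proj s mod int n" using proj_step st by simp
    then have "c (proj t) = c (proj s)" by (simp add: c_eq_iff)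
    moreover have "cyc_norm n (j - proj t) = cyc_norm n (j - proj s)"
      using eq by (intro cyc_norm_cong) (rule mod_diff_cong[OF refl])
    moreover have "dist t x \<le> dist s x + 1" if "x \<in> verts G" for x
      using dist_step[OF that st] that st adj_in_verts[OF st] by (simp add: dist_sym)
    ultimately show ?thesis by (simp add: h_def)
  qed
  then have "h w \<le> h (c j) + dist (c j) w"
    using w by (intro lipschitz_dist) auto
  then show "dist w (c (proj w)) + cyc_norm n (j - proj w) \<le> dist w (c j)"
    using w by (simp add: h_c dist_sym) (simp add: h_def)
qed

lemma slope_c:
  assumes "w \<in> verts G"
  shows "slope (c j) (c (j + 1)) w = cyc_slope n (j - proj w)"
  using dist_c[OF assms, of j] dist_c[OF assms, of "j + 1"]
  by (simp add: slope_def cyc_slope_def algebra_simps)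

lemma slope_rest:
  assumes "(s, t) \<in> rest"
  shows "slope s t (c i) = slope s t (c j)"
proof -
  have st: "s \<in> verts G" "t \<in> verts G" using assms adj_in_verts by auto
  have "cyc_norm n (l - proj t) = cyc_norm n (l - proj s)" for l
    using proj_step[OF assms] by (intro cyc_norm_cong) (rule mod_diff_cong[OF refl])
  then show ?thesis
    using dist_c[OF st(1), of i] dist_c[OF st(1), of j] dist_c[OF st(2), of i] dist_c[OF st(2), of j]
    by (simp add: slope_def dist_sym[OF c_in_verts] st)
qed

lemma sum_cycle_edges:
  fixes f :: "'a \<Rightarrow> 'a \<Rightarrow> int"
  shows "(\<Sum>(s, t) \<in> cycle_edges c. f s t)
    = (\<Sum>j<n. f (c (int j)) (c (int j + 1)) + f (c (int j + 1)) (c (int j)))"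
proof -
  let ?F = "\<lambda>j::nat. (c (int j), c (int j + 1))" and ?B = "\<lambda>j::nat. (c (int j + 1), c (int j))"
  have red: "\<exists>j<n. c i = c (int j) \<and> c (i + 1) = c (int j + 1)" for i
    using n_pos by (intro exI[of _ "nat (i mod int n)"]) (auto simp: c_eq_iff nat_less_iff mod_simps)
  have "cycle_edges c = ?F ` {..<n} \<union> ?B ` {..<n}"
  proof
    show "cycle_edges c \<subseteq> ?F ` {..<n} \<union> ?B ` {..<n}"
    proof
      fix x assume "x \<in> cycle_edges c"
      then obtain i where "x = (c i, c (i + 1)) \<or> x = (c (i + 1), c i)" by (auto simp: cycle_edges_def)
      then show "x \<in> ?F ` {..<n} \<union> ?B ` {..<n}" using red[of i] by auto
    qed
  qed (auto simp: cycle_edges_def)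
  moreover have "?F ` {..<n} \<inter> ?B ` {..<n} = {}"
  proof -
    \<comment> \<open>A pair occurring in both families would make \<open>n\<close> a divisor of 2;
      this is where \<open>3 \<le> n\<close> matters.\<close>
    have False if "c i = c (j + 1)" "c (i + 1) = c j" for i j
    proof -
      have "int n dvd i - (j + 1)" "int n dvd (i + 1) - j"
        using that by (simp_all add: c_eq_iff mod_eq_dvd_iff)
      then have "int n dvd ((i + 1) - j) - (i - (j + 1))" by (rule dvd_diff[rotated])
      then have "int n dvd 2" by simp
      then show False using n_ge zdvd_imp_le[of "int n" 2] by simp
    qed
    then show ?thesis by blast
  qed
  moreover have "inj_on ?F {..<n}" "inj_on ?B {..<n}"
    by (auto simp: inj_on_def c_eq_iff)
  ultimately show ?thesis
    by (simp add: sum.union_disjoint sum.reindex sum.distrib)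
qed

text \<open>Edges off the cycle contribute the same amount for every cycle vertex
  \<open>c l\<close>, and the cycle edges contribute \<open>8 * cyc_norm n (l - proj u)\<close>. By
  \<open>dist_c\<close> this is exactly the part of \<open>8 * dist u (c l)\<close> that depends on
  \<open>l\<close>.\<close>

lemma cut_dist_c:
  assumes u: "u \<in> verts G"
  shows "cut_dist u (c i) - 8 * dist u (c i) = cut_dist u (c j) - 8 * dist u (c j)"
proof -
  have flip: "slope t s w = - slope s t w" for s t w by (simp add: slope_def)
  have "cut_dist u (c l) - 8 * dist u (c l)
    = (\<Sum>(s, t) \<in> rest. \<bar>slope s t u - slope s t (c 0)\<bar>) - 8 * dist u (c (proj u))" for l
  proof -
    let ?f = "\<lambda>s t. \<bar>slope s t u - slope s t (c l)\<bar>"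
    have "cut_dist u (c l) = (\<Sum>(s, t) \<in> rest. ?f s t) + (\<Sum>(s, t) \<in> cycle_edges c. ?f s t)"
      unfolding cut_dist_def by (rule sum.subset_diff[OF cycle_edges_subset finite_ends])
    also have "(\<Sum>(s, t) \<in> rest. ?f s t) = (\<Sum>(s, t) \<in> rest. \<bar>slope s t u - slope s t (c 0)\<bar>)"
      using slope_rest by (intro sum.cong) (auto split: prod.splits, metis DiffI)
    also have "(\<Sum>(s, t) \<in> cycle_edges c. ?f s t)
        = (\<Sum>j<n. 2 * \<bar>cyc_slope n (int j - proj u) - cyc_slope n (int j - l)\<bar>)"
    proof -
      have "cyc_slope n (a - proj (c l)) = cyc_slope n (a - l)" for a
        using proj_c by (intro cyc_slope_cong) (rule mod_diff_cong[OF refl])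
      then show ?thesis
        unfolding sum_cycle_edges flip[of "c (int _ + 1)"] using u
        by (intro sum.cong refl) (simp add: slope_c)
    qed
    also have "\<dots> = 8 * cyc_norm n (l - proj u)"
      by (simp add: sum_distrib_left[symmetric] sum_cyc_slope_diff n_pos)
    finally show ?thesis using dist_c[OF u, of l] by simp
  qed
  then show ?thesis by simp
qed

end

section \<open>Graphs whose blocks are cycles\<close>

lemma (in wf_digraph) cas_nth_Suc:
  assumes "cas u p v" "Suc i < length p"
  shows "tail G (p ! Suc i) = head G (p ! i)"
  using assms
proof (induction p arbitrary: u i)
  case (Cons a p)
  then show ?case by (cases i; cases p) auto
qed simp

lemma (in wf_digraph) ucycle_parametrization:
  assumes "ucycle G p"
  obtains c :: "int \<Rightarrow> 'a" where
    "\<forall>i j. c i = c j \<longleftrightarrow> i mod int (length p) = j mod int (length p)"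
    "cycle_edges c = (\<Union>a \<in> set p. {(tail G a, head G a), (head G a, tail G a)})"
proof -
  let ?n = "length p"
  define a where "a i = p ! nat (i mod int ?n)" for i
  \<comment> \<open>Heads and not tails, since \<open>cycle\<close> asserts distinctness of
    \<open>tl (awalk_verts u p)\<close>, which is the list of heads.\<close>
  define c where "c i = head G (a i)" for i
  obtain u where u: "awalk u p u" "distinct (tl (awalk_verts u p))" and n: "3 \<le> ?n"
    using assms by (auto simp: ucycle_def cycle_def)
  have cas: "cas u p u" using u(1) by auto
  have nonneg: "0 \<le> l mod int ?n" for l using n by (intro pos_mod_sign) linarith
  have idx: "nat (i mod int ?n) < ?n" for i
  proof -
    have "i mod int ?n < int ?n" "0 \<le> i mod int ?n"
      using n by (intro pos_mod_bound pos_mod_sign; linarith)+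
    then show ?thesis by linarith
  qed
  have "distinct (map (head G) p)"
  proof -
    have "p \<noteq> []" using n by auto
    then show ?thesis using u(2) awalk_verts_conv'[OF cas] by simp
  qed
  then have eq: "c i = c j \<longleftrightarrow> i mod int ?n = j mod int ?n" for i j
    using idx[of i] idx[of j] nonneg \<open>distinct (map _ _)\<close>
    by (auto simp: c_def a_def distinct_map inj_on_eq_iff nth_eq_iff_index_eq eq_nat_nat_iff)
  have tail_a: "tail G (a (i + 1)) = c i" for i
  proof (cases "Suc (nat (i mod int ?n)) < ?n")
    case True
    have "(i + 1) mod int ?n = (i mod int ?n + 1) mod int ?n" by (simp add: mod_simps)
    also have "\<dots> = i mod int ?n + 1" using True nonneg[of i] by (intro mod_pos_pos_trivial) linarith+
    finally have "nat ((i + 1) mod int ?n) = Suc (nat (i mod int ?n))"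
      using nonneg[of i] by (simp add: Suc_nat_eq_nat_zadd1 add.commute)
    then show ?thesis using cas_nth_Suc[OF cas True] by (simp add: a_def c_def)
  next
    case False
    \<comment> \<open>After the last arc the index wraps to 0, and the ends match because the walk
      is closed.\<close>
    with idx[of i] have last: "nat (i mod int ?n) = ?n - 1" by linarith
    then have "i mod int ?n + 1 = int ?n" using n nonneg[of i] by linarith
    then have "(i + 1) mod int ?n = 0" by (metis mod_add_left_eq mod_self)
    moreover have "p \<noteq> []" using n by auto
    moreover have "tail G (hd p) = u" using cas by (simp add: cas_simp[OF \<open>p \<noteq> []\<close>])
    moreover have "head G (last p) = u"
      using awlast_if_cas[OF cas] \<open>p \<noteq> []\<close> by (simp add: awalk_verts_conv)
    ultimately show ?thesis by (simp add: a_def c_def last hd_conv_nth last_conv_nth)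
  qed
  have "set p = range (\<lambda>i. a (i + 1))"
  proof
    show "range (\<lambda>i. a (i + 1)) \<subseteq> set p" using idx by (auto simp: a_def)
    show "set p \<subseteq> range (\<lambda>i. a (i + 1))"
    proof
      fix x assume "x \<in> set p"
      then obtain i where "i < ?n" "x = p ! i" by (auto simp: in_set_conv_nth)
      then have "x = a ((int i - 1) + 1)" by (simp add: a_def)
      then show "x \<in> range (\<lambda>i. a (i + 1))" by blast
    qed
  qed
  then have "(\<Union>a \<in> set p. {(tail G a, head G a), (head G a, tail G a)}) = cycle_edges c"
    by (simp only: cycle_edges_def image_image tail_a c_def[symmetric])
  with eq show thesis using that[of c] by simp
qed

lemma cycle_graph_parametrization:
  fixes H :: "('a, 'b) pre_digraph"
  assumes "cycle_graph H"
  obtains p and c :: "int \<Rightarrow> 'a" where "ucycle H p"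
    "\<forall>i j. c i = c j \<longleftrightarrow> i mod int (length p) = j mod int (length p)"
    "arcs_ends H = cycle_edges c" "range c \<subseteq> verts H"
proof -
  obtain p where p: "ucycle H p" "uedges H = (\<lambda>a. {tail H a, head H a}) ` set p"
    and "graph H" using assms by (auto simp: cycle_graph_def)
  interpret graph H by fact
  obtain c :: "int \<Rightarrow> 'a" where
    c: "\<forall>i j. c i = c j \<longleftrightarrow> i mod int (length p) = j mod int (length p)"
      "cycle_edges c = (\<Union>a \<in> set p. {(tail H a, head H a), (head H a, tail H a)})"
    by (rule ucycle_parametrization[OF p(1)])
  have "arcs_ends H \<subseteq> cycle_edges c"
  proof clarify
    fix s t assume "s \<rightarrow>\<^bsub>H\<^esub> t"
    then have "{s, t} \<in> uedges H" by (auto simp: uedges_def)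
    then obtain a where "a \<in> set p" "{s, t} = {tail H a, head H a}" unfolding p(2) by blast
    then show "(s, t) \<in> cycle_edges c" unfolding c(2) doubleton_eq_iff by blast
  qed
  moreover have "set p \<subseteq> arcs H" using p(1) by (auto simp: ucycle_def cycle_def)
  then have "cycle_edges c \<subseteq> arcs_ends H"
    unfolding c(2) using graph_symmetric in_arcs_imp_in_arcs_ends by blast
  ultimately have eq: "arcs_ends H = cycle_edges c" by blast
  moreover have "range c \<subseteq> verts H"
  proof clarify
    fix i
    have "(c i, c (i + 1)) \<in> arcs_ends H" unfolding eq by (auto simp: cycle_edges_def)
    then show "c i \<in> verts H" by (rule adj_in_verts)
  qed
  ultimately show thesis using that[OF p(1) c(1)] by simp
qed

lemma arcs_ends_del_edge: "arcs_ends (del_edge G u v) = arcs_ends G - {(u, v), (v, u)}"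
  by (auto simp: arcs_ends_conv del_edge_def doubleton_eq_iff)

text \<open>The block of a bridge has at most two vertices, whereas \<open>c 0\<close>,
  \<open>c 1\<close> and \<open>c 2\<close> are distinct on a cycle.\<close>

lemma no_bridge_if_blocks_cycles:
  fixes G :: "('a, 'b) pre_digraph"
  assumes "\<forall>H. is_block G H \<longrightarrow> cycle_graph H"
  shows "\<not> bridge G u v"
proof
  assume "bridge G u v"
  then have "cycle_graph (G \<restriction> {u, v})" using assms by (auto simp: is_block_def)
  then obtain p and c :: "int \<Rightarrow> 'a" where p: "ucycle (G \<restriction> {u, v}) p"
    and c: "\<forall>i j. c i = c j \<longleftrightarrow> i mod int (length p) = j mod int (length p)"
    and "arcs_ends (G \<restriction> {u, v}) = cycle_edges c" and sub: "range c \<subseteq> verts (G \<restriction> {u, v})"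
    by (rule cycle_graph_parametrization)
  have "3 \<le> length p" using p by (simp add: ucycle_def)
  then have "c 0 \<noteq> c 1" "c 0 \<noteq> c 2" "c 1 \<noteq> c 2" by (simp_all add: c)
  moreover have "c 0 \<in> {u, v}" "c 1 \<in> {u, v}" "c 2 \<in> {u, v}" using sub by auto
  ultimately show False by auto
qed

context connected_graph
begin

text \<open>As \<open>xy\<close> is no bridge, a path joins its ends without it. This path is an ear
  on the edge, so together they form a 2-connected \<open>K\<close>, which extends to a block
  \<open>H\<close>, a cycle by hypothesis. If two vertices of \<open>H\<close> were still connected
  off the edges of \<open>H\<close>, a connecting path would be an ear on \<open>H\<close> and yield
  a larger 2-connected subgraph \<open>L\<close>.\<close>

lemma edge_in_block_cycle:
  assumes blocks: "\<forall>H. is_block G H \<longrightarrow> cycle_graph H" and xy: "(x, y) \<in> arcs_ends G"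
  obtains p c where "ucycle G p" "block_cycle G (length p) c" "(x, y) \<in> cycle_edges c"
proof -
  have "x \<noteq> y" using xy adj_not_same by blast
  have "\<not> bridge G x y" using blocks by (rule no_bridge_if_blocks_cycles)
  then have "(x, y) \<in> (arcs_ends G - {(x, y), (y, x)})\<^sup>*"
    using xy reachable_rtranclI by (fastforce simp: bridge_def arcs_ends_del_edge)
  then obtain m q where q: "q 0 = x" "q m = y" "inj_on q {..m}"
    and q_step: "\<forall>i<m. (q i, q (Suc i)) \<in> arcs_ends G - {(x, y), (y, x)}"
    by (rule rtrancl_simple_path)
  have path: "path_edges q m \<subseteq> arcs_ends G" "path_edges q m \<subseteq> q ` {..m} \<times> q ` {..m}"
    using q_step sym_ends by (auto simp: path_edges_def dest: symD)
  define K where "K = edge_subgraph G ({x, y} \<union> q ` {..m}) ({(x, y), (y, x)} \<union> path_edges q m)"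
  have in_G: "{x, y} \<union> q ` {..m} \<subseteq> verts G"
  proof -
    have "q i \<in> verts G" if "i \<le> m" for i
    proof (cases "i = m")
      case True
      then show ?thesis using q xy adj_in_verts by blast
    next
      case False
      then show ?thesis using q_step[rule_format, of i] that adj_in_verts by auto
    qed
    then show ?thesis using xy adj_in_verts by auto
  qed
  have "sym ({(x, y), (y, x)} \<union> path_edges q m)"
    by (rule sym_Un[OF _ sym_path_edges]) (auto simp: sym_def)
  moreover have "{(x, y), (y, x)} \<union> path_edges q m \<subseteq> arcs_ends G"
    using xy path(1) sym_ends by (auto dest: symD)
  moreover have "{(x, y), (y, x)} \<union> path_edges q m
      \<subseteq> ({x, y} \<union> q ` {..m}) \<times> ({x, y} \<union> q ` {..m})"
    using path(2) by blast
  ultimately have K: "subgraph K G" "graph K" "arcs_ends K = {(x, y), (y, x)} \<union> path_edges q m"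
    "verts K = {x, y} \<union> q ` {..m}"
    unfolding K_def using in_G by (simp_all add: edge_subgraph)
  have "two_connected K"
  proof -
    \<comment> \<open>The path has neither length 0, as \<open>x \<noteq> y\<close>, nor length 1,
      as it avoids the edge \<open>xy\<close>; so \<open>q 1\<close> is a third vertex.\<close>
    have "m \<noteq> 0" using q \<open>x \<noteq> y\<close> by metis
    moreover from this have "m \<noteq> 1" using q q_step[rule_format, of 0] by auto
    ultimately have "q 1 \<notin> {x, y}"
      using q inj_onD[OF q(3), of 1 0] inj_onD[OF q(3), of 1 m] by auto
    then have "card {x, y, q 1} = 3" using \<open>x \<noteq> y\<close> by auto
    moreover have "{x, y, q 1} \<subseteq> verts K" using K \<open>m \<noteq> 0\<close> by auto
    ultimately have "2 < card (verts K)"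
      using card_mono[of "verts K" "{x, y, q 1}"] K(4) by auto
    moreover have "robust (verts K) (arcs_ends K)"
      unfolding K using q robust_edge by (intro robust_ear) (auto simp: sym_def)
    ultimately show ?thesis using K(2) two_connected_iff_robust by blast
  qed
  then obtain H where max: "max_subgraph two_connected H" and KH: "subgraph K H"
    by (rule subgraph_of_max_subgraph[OF K(1)])
  then have H: "subgraph H G" "two_connected H" and cyc: "cycle_graph H"
    using blocks by (auto simp: max_subgraph_def is_block_def)
  obtain p and c :: "int \<Rightarrow> 'a" where p: "ucycle H p"
    and c: "\<forall>i j. c i = c j \<longleftrightarrow> i mod int (length p) = j mod int (length p)"
    and ends: "arcs_ends H = cycle_edges c" and range_c: "range c \<subseteq> verts H"
    by (rule cycle_graph_parametrization[OF cyc])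
  have "graph H" and card_H: "2 < card (verts H)" using H(2) by (auto simp: two_connected_def)
  interpret H: graph H by fact
  have HG: "arcs_ends H \<subseteq> arcs_ends G" using H(1) by (auto dest: arcs_ends_mono)
  have "block_cycle G (length p) c"
  proof
    show "3 \<le> length p" using p by (simp add: ucycle_def)
    show "c i = c j \<longleftrightarrow> i mod int (length p) = j mod int (length p)" for i j using c by blast
    show "(c i, c (i + 1)) \<in> arcs_ends G" for i
      using HG ends by (auto simp: cycle_edges_def)
    show "c i = c j" if "(c i, c j) \<in> (arcs_ends G - cycle_edges c)\<^sup>*" for i j
    proof (rule ccontr)
      assume "c i \<noteq> c j"
      from that obtain m q where q: "q 0 = c i" "q m = c j" "inj_on q {..m}"
        and q_step: "\<forall>i<m. (q i, q (Suc i)) \<in> arcs_ends G - cycle_edges c"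
        by (rule rtrancl_simple_path)
      have "0 < m" using q \<open>c i \<noteq> c j\<close> by (cases m) auto
      have path: "path_edges q m \<subseteq> arcs_ends G" "path_edges q m \<subseteq> q ` {..m} \<times> q ` {..m}"
        using q_step sym_ends by (auto simp: path_edges_def dest: symD)
      define L where "L = edge_subgraph G (verts H \<union> q ` {..m}) (arcs_ends H \<union> path_edges q m)"
      have in_G: "verts H \<union> q ` {..m} \<subseteq> verts G"
      proof -
        have "q l \<in> verts G" if "l \<le> m" for l
        proof (cases "l = m")
          case True
          then show ?thesis using q range_c H(1) by auto
        next
          case False
          then show ?thesis using q_step[rule_format, of l] that adj_in_verts by auto
        qed
        then show ?thesis using H(1) by auto
      qed
      have "sym (arcs_ends H)" using H.sym_arcs by (simp add: symmetric_def)
      then have symL: "sym (arcs_ends H \<union> path_edges q m)"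
        using sym_path_edges by (rule sym_Un)
      have subL: "arcs_ends H \<union> path_edges q m
          \<subseteq> (verts H \<union> q ` {..m}) \<times> (verts H \<union> q ` {..m})"
        using path H.adj_in_verts by auto
      have endsL: "arcs_ends H \<union> path_edges q m \<subseteq> arcs_ends G" using HG path by auto
      note L = edge_subgraph[OF in_G endsL symL subL, folded L_def]
      have "robust (verts L) (arcs_ends L)"
        unfolding L(3,4) using H(2) card_H \<open>graph H\<close> \<open>sym (arcs_ends H)\<close> q range_c
        by (intro robust_ear) (auto simp: two_connected_iff_robust)
      moreover have "2 < card (verts L)"
        using card_H card_mono[of "verts L" "verts H"] L(4) by simp
      ultimately have "two_connected L" using L(2) two_connected_iff_robust by blast
      moreover have "subgraph H L"
      proof -
        have "compatible G H" "arcs H \<subseteq> arcs G" using H(1) by auto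
        then have "arcs H \<subseteq> arcs L"
          by (auto simp: L_def edge_subgraph_def arcs_ends_conv compatible_def)
        moreover have "wf_digraph L" using L(1) by (simp add: subgraph_def)
        moreover have "compatible L H"
          using \<open>compatible G H\<close> by (simp add: L_def edge_subgraph_def compatible_def)
        ultimately show ?thesis using H.wf_digraph L(4) by (simp add: subgraph_def)
      qed
      ultimately have "L = H" using max L(1) by (auto simp: max_subgraph_def)
      \<comment> \<open>The first edge of the ear lies in \<open>L\<close> but not in
        \<open>cycle_edges c\<close>, which is all of \<open>arcs_ends H\<close>.\<close>
      moreover have "(q 0, q 1) \<in> arcs_ends L"
        unfolding L(3) using \<open>0 < m\<close> by (auto simp: path_edges_def)
      ultimately show False using q_step[rule_format, of 0] \<open>0 < m\<close> ends by auto
    qed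
  qed
  moreover have "ucycle G p"
    using p subgraph_cycle H(1) by (auto simp: ucycle_def)
  moreover have "(x, y) \<in> cycle_edges c"
    using arcs_ends_mono[OF KH] K(3) ends by auto
  ultimately show thesis using that by blast
qed

text \<open>Both sides vanish at \<open>v = u\<close>. Each edge of a walk from \<open>u\<close> to
  \<open>v\<close> lies on a block cycle, where the difference of the two sides is constant.\<close>

lemma cut_dist_eq:
  assumes blocks: "\<forall>H. is_block G H \<longrightarrow> cycle_graph H" and uv: "u \<in> verts G" "v \<in> verts G"
  shows "cut_dist u v = 8 * dist u v"
proof -
  have "(u, v) \<in> (arcs_ends G)\<^sup>*" using uv by (rule rtrancl_ends)
  then show ?thesis
  proof induction
    case base
    then show ?case using uv by (simp add: cut_dist_def)
  next
    case (step x y)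
    obtain p c where "ucycle G p" "block_cycle G (length p) c" and xy: "(x, y) \<in> cycle_edges c"
      by (rule edge_in_block_cycle[OF blocks step(2)])
    interpret block_cycle G "length p" c by fact
    from xy obtain i j where "x = c i" "y = c j" by (auto simp: cycle_edges_def)
    then show ?case using cut_dist_c[OF uv(1), of i j] step.IH by simp
  qed
qed

text \<open>If no edge has an equidistant vertex, the distance from a fixed vertex changes parity
  along every arc, so all closed walks are even. Conversely, every edge lies on a block cycle; its
  length is even, and slopes on an even cycle never vanish.\<close>

lemma equidistant_free_iff_even_cycles:
  assumes blocks: "\<forall>H. is_block G H \<longrightarrow> cycle_graph H"
  shows "(\<forall>(s, t) \<in> arcs_ends G. \<forall>w \<in> verts G. slope s t w \<noteq> 0) \<longleftrightarrow> (\<forall>p. ucycle G p \<longrightarrow> even (length p))"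
proof
  assume nz: "\<forall>(s, t) \<in> arcs_ends G. \<forall>w \<in> verts G. slope s t w \<noteq> 0"
  have parity: "even (dist w v - dist w u - int (length p))"
    if "awalk u p v" "w \<in> verts G" for w u p v
    using that(1)
  proof (induction p arbitrary: u)
    case (Cons a p)
    then have a: "(u, head G a) \<in> arcs_ends G" by (auto simp: awalk_Cons_iff arcs_ends_conv)
    have "even (dist w v - dist w (head G a) - int (length p))"
      using Cons by (simp add: awalk_Cons_iff)
    moreover have "slope u (head G a) w \<noteq> 0" "\<bar>slope u (head G a) w\<bar> \<le> 1"
      using nz a that(2) slope_abs_le by auto
    then have "gdist G w u = Suc (gdist G w (head G a)) \<or> gdist G w (head G a) = Suc (gdist G w u)"
      by (auto simp: slope_def)
    then have "odd (dist w u - dist w (head G a))" by auto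
    ultimately show ?case by auto
  qed (simp add: awalk_Nil_iff)
  show "\<forall>p. ucycle G p \<longrightarrow> even (length p)"
  proof (intro allI impI)
    fix p assume "ucycle G p"
    then obtain u where "awalk u p u" by (auto simp: ucycle_def cycle_def)
    then show "even (length p)" using parity[of u p u u] by (auto simp: awalk_hd_in_verts)
  qed
next
  assume even: "\<forall>p. ucycle G p \<longrightarrow> even (length p)"
  have "slope s t w \<noteq> 0" if st: "(s, t) \<in> arcs_ends G" and w: "w \<in> verts G" for s t w
  proof -
    obtain p c where "ucycle G p" "block_cycle G (length p) c" and st: "(s, t) \<in> cycle_edges c"
      by (rule edge_in_block_cycle[OF blocks st])
    interpret block_cycle G "length p" c by fact
    have "slope (c j) (c (j + 1)) w \<noteq> 0" for j
      using even \<open>ucycle G p\<close> n_pos w by (simp add: slope_c cyc_slope_nonzero)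
    moreover have "slope (c (j + 1)) (c j) w = - slope (c j) (c (j + 1)) w" for j
      by (simp add: slope_def)
    ultimately show ?thesis using st by (auto simp: cycle_edges_def)
  qed
  then show "\<forall>(s, t) \<in> arcs_ends G. \<forall>w \<in> verts G. slope s t w \<noteq> 0" by blast
qed

section \<open>The two indices as sums over pairs of vertices\<close>

lemma szeged_term_eq:
  assumes st: "(s, t) \<in> arcs_ends G"
  shows "4 * szeged_term G s t
    = (\<Sum>u \<in> verts G. \<Sum>v \<in> verts G. real_of_int \<bar>slope s t u - slope s t v\<bar>) + (real (n_equidistant G s t))\<^sup>2"
proof -
  let ?V = "verts G" and ?e = "\<lambda>w. slope s t w" and ?z = "\<lambda>w. of_bool (slope s t w = 0) :: int"
  have e: "?e w = -1 \<or> ?e w = 0 \<or> ?e w = 1" if "w \<in> ?V" for w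
    using slope_abs_le[OF that st] by linarith
  have card: "int (card {w \<in> ?V. P w}) = (\<Sum>w\<in>?V. of_bool (P w))" for P
    by (simp add: Int_def conj_commute)
  have o: "int (n_equidistant G s t) = (\<Sum>w\<in>?V. ?z w)"
    unfolding n_equidistant_def card by (simp add: slope_def)
  have o': "n_equidistant G t s = n_equidistant G s t"
    unfolding n_equidistant_def by metis
  \<comment> \<open>A vertex contributes 2, 1 or 0 to the left side according as its slope is -1, 0
    or 1.\<close>
  have s: "2 * int (n_closer G s t) + int (n_equidistant G s t) = (\<Sum>w\<in>?V. 1 - ?e w)"
    unfolding n_closer_def o card sum_distrib_left sum.distrib[symmetric]
    using e by (intro sum.cong refl) (force simp: slope_def)
  have t: "2 * int (n_closer G t s) + int (n_equidistant G s t) = (\<Sum>w\<in>?V. 1 + ?e w)"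
    unfolding n_closer_def o card sum_distrib_left sum.distrib[symmetric]
    using e by (intro sum.cong refl) (force simp: slope_def)
  \<comment> \<open>The mixed terms \<open>?e v - ?e u\<close> cancel over ordered pairs.\<close>
  have "(\<Sum>w\<in>?V. 1 - ?e w) * (\<Sum>w\<in>?V. 1 + ?e w) = (\<Sum>u\<in>?V. \<Sum>v\<in>?V. 1 - ?e u * ?e v)"
    by (simp add: sum.distrib sum_subtractf sum_product[symmetric] algebra_simps)
  also have "\<dots> = (\<Sum>u\<in>?V. \<Sum>v\<in>?V. \<bar>?e u - ?e v\<bar> + ?z u * ?z v)"
  proof (intro sum.cong refl)
    fix u v assume "u \<in> ?V" "v \<in> ?V"
    then show "1 - ?e u * ?e v = \<bar>?e u - ?e v\<bar> + ?z u * ?z v"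
      using e[of u] e[of v] by auto
  qed
  also have "\<dots> = (\<Sum>u\<in>?V. \<Sum>v\<in>?V. \<bar>?e u - ?e v\<bar>) + (int (n_equidistant G s t))\<^sup>2"
    unfolding o power2_eq_square sum_product sum.distrib ..
  finally have "(2 * int (n_closer G s t) + int (n_equidistant G s t))
      * (2 * int (n_closer G t s) + int (n_equidistant G s t))
      = (\<Sum>u\<in>?V. \<Sum>v\<in>?V. \<bar>?e u - ?e v\<bar>) + (int (n_equidistant G s t))\<^sup>2"
    unfolding s t .
  from arg_cong[OF this, of real_of_int] show ?thesis
    unfolding szeged_term_def o' by (simp add: algebra_simps power2_eq_square)
qed

lemma szeged_minus_wiener:
  assumes blocks: "\<forall>H. is_block G H \<longrightarrow> cycle_graph H"
  shows "8 * (revised_szeged_index G - 2 * wiener_index G)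
    = (\<Sum>(s, t) \<in> arcs_ends G. (real (n_equidistant G s t))\<^sup>2)"
proof -
  let ?A = "arcs_ends G" and ?V = "verts G"
  \<comment> \<open>Without parallel arcs the sum may run over \<open>arcs_ends\<close>. The factor
    1/2 leaves 4 of the 8, which clears the halves in both factors of a term.\<close>
  have "8 * revised_szeged_index G = (\<Sum>(s, t) \<in> ?A. 4 * szeged_term G s t)"
    unfolding revised_szeged_index_def arcs_ends_def sum.reindex[OF inj_on_arc_to_ends]
    by (simp add: arc_to_ends_def sum_distrib_left)
  also have "\<dots> = (\<Sum>(s, t) \<in> ?A. (\<Sum>u\<in>?V. \<Sum>v\<in>?V. real_of_int \<bar>slope s t u - slope s t v\<bar>)
      + (real (n_equidistant G s t))\<^sup>2)"
    by (intro sum.cong refl) (auto simp: szeged_term_eq)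
  also have "\<dots> = (\<Sum>(s, t) \<in> ?A. \<Sum>u\<in>?V. \<Sum>v\<in>?V. real_of_int \<bar>slope s t u - slope s t v\<bar>)
      + (\<Sum>(s, t) \<in> ?A. (real (n_equidistant G s t))\<^sup>2)"
    by (simp add: case_prod_unfold sum.distrib)
  also have "(\<Sum>(s, t) \<in> ?A. \<Sum>u\<in>?V. \<Sum>v\<in>?V. real_of_int \<bar>slope s t u - slope s t v\<bar>)
      = (\<Sum>u\<in>?V. \<Sum>v\<in>?V. \<Sum>(s, t) \<in> ?A. real_of_int \<bar>slope s t u - slope s t v\<bar>)"
    unfolding case_prod_unfold by (subst sum.swap) (intro sum.cong refl sum.swap)
  also have "\<dots> = (\<Sum>u\<in>?V. \<Sum>v\<in>?V. real_of_int (cut_dist u v))"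
    by (simp add: cut_dist_def case_prod_unfold)
  \<comment> \<open>Here 16 is the 8 of \<open>cut_dist_eq\<close> times 2, as each pair of vertices
    occurs in both orders.\<close>
  also have "\<dots> = 16 * wiener_index G"
    by (simp add: cut_dist_eq[OF blocks] wiener_index_def sum_distrib_left)
  finally show ?thesis by simp
qed

end

theorem theorem4p2:
  fixes G :: "('a, 'b) pre_digraph"
  assumes "graph G"
    and "Digraph_Component.connected G"
    and "\<And>H. is_block G H \<Longrightarrow> cycle_graph H"
  shows "2 * wiener_index G \<le> revised_szeged_index G
    \<and> (2 * wiener_index G = revised_szeged_index G
         \<longleftrightarrow> (\<forall>p. ucycle G p \<longrightarrow> even (length p)))"
proof -
  interpret connected_graph G
    using assms(1,2) by (simp add: connected_graph_def connected_graph_axioms_def)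
  have blocks: "\<forall>H. is_block G H \<longrightarrow> cycle_graph H" using assms(3) by blast
  let ?S = "\<Sum>(s, t) \<in> arcs_ends G. (real (n_equidistant G s t))\<^sup>2"
  have eq: "8 * (revised_szeged_index G - 2 * wiener_index G) = ?S"
    using blocks by (rule szeged_minus_wiener)
  have "0 \<le> ?S" by (intro sum_nonneg) auto
  have "?S = 0 \<longleftrightarrow> (\<forall>(s, t) \<in> arcs_ends G. n_equidistant G s t = 0)"
    by (subst sum_nonneg_eq_0_iff) (auto simp: finite_ends)
  also have "\<dots> \<longleftrightarrow> (\<forall>(s, t) \<in> arcs_ends G. \<forall>w \<in> verts G. slope s t w \<noteq> 0)"
    by (auto simp: n_equidistant_def slope_def)
  also have "\<dots> \<longleftrightarrow> (\<forall>p. ucycle G p \<longrightarrow> even (length p))"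
    using blocks by (rule equidistant_free_iff_even_cycles)
  finally show ?thesis using eq \<open>0 \<le> ?S\<close> by auto
qed

end
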